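(* Let $p$ be a prime, $A\in\mathbb{F}_p^{n\times n}$, and consider the finite-field network $x[k+1]=Ax[k]$ over $\mathbb{F}_p$ with outputs $y_j[k]=x_j[k]$, $j=1,\dots,h$. If its interaction digraph (with $v_1,\dots,v_h$ marked as directly observable) satisfies both Property $P_1$ and Property $P_2$, then the network is strongly structurally observable.
   Context: All operations are in the finite field $\mathbb{F}_p=\{0,1,\dots,p-1\}$; $x[k]\in\mathbb{F}_p^n$, $k=0,1,2,\dots$. The interaction digraph of the network has vertices $v_1,\dots,v_n$, and the in-neighbors of $v_i$ are exactly the $v_j$ with $a_{ij}\neq 0$, where $A=(a_{ij})$. The network is observable if for any two different initial states at $k=0$ the output sequences differ at some time $k\ge 0$. For $A,A'\in\mathbb{F}_p^{n\times n}$ write $A\sim A'$ if the positions of the positive (i.e. nonzero) elements in $A$ and $A'$ are identical. The network is strongly structurally observable if for every $A'\in\mathbb{F}_p^{n\times n}$ with $A'\sim A$ the network $x[k+1]=A'x[k]$ (with the same outputs $y_j=x_j$, $j=1,\dots,h$) is observable. Vertices $v_1,\dots,v_h$ are called directly observable; the others simple. A cycle is a closed walk along directed edges without repeated vertices other than start = end (a self-loop is a cycle). Property $P_1$: for every simple vertex $v$ there is a vertex $v'$ whose unique in-neighbor is $v$. Property $P_2$: for every cycle $C$ consisting entirely of simple vertices there is a vertex $v\notin C$ whose unique in-neighbor is some vertex of $C$. *)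

theory Defs
  imports
    "Berlekamp_Zassenhaus.Finite_Field"
    "Jordan_Normal_Form.Matrix"
    "Graph_Theory.Pair_Digraph"
begin

text \<open>
  The field with \<open>p\<close> elements is \<open>'p mod_ring\<close> with \<open>'p :: prime_card\<close> and \<open>p = CARD('p)\<close>.
  Indices start at 0: the vertex \<open>v_i\<close> and the coordinate \<open>x_i\<close> have index \<open>i - 1\<close>, so the
  directly observable vertices \<open>v_1, \<dots>, v_h\<close> are \<open>{..<h}\<close>.
\<close>

fun state :: "'a::semiring_0 mat \<Rightarrow> 'a vec \<Rightarrow> nat \<Rightarrow> 'a vec" where
  "state A x 0 = x"
| "state A x (Suc k) = A *\<^sub>v state A x k"

definition network_output :: "nat \<Rightarrow> 'a::semiring_0 mat \<Rightarrow> 'a vec \<Rightarrow> nat \<Rightarrow> 'a vec" where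
  "network_output h A x k = vec_first (state A x k) h"

definition observable :: "nat \<Rightarrow> nat \<Rightarrow> 'a::semiring_0 mat \<Rightarrow> bool" where
  "observable n h A \<longleftrightarrow>
    (\<forall>x \<in> carrier_vec n. \<forall>z \<in> carrier_vec n. x \<noteq> z \<longrightarrow>
      (\<exists>k. network_output h A x k \<noteq> network_output h A z k))"

definition same_pattern :: "nat \<Rightarrow> 'a::zero mat \<Rightarrow> 'a mat \<Rightarrow> bool" where
  "same_pattern n A A' \<longleftrightarrow>
    (\<forall>i<n. \<forall>j<n. A $$ (i, j) \<noteq> 0 \<longleftrightarrow> A' $$ (i, j) \<noteq> 0)"

definition strongly_structurally_observable ::
    "nat \<Rightarrow> nat \<Rightarrow> 'p::prime_card mod_ring mat \<Rightarrow> bool" where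
  "strongly_structurally_observable n h A \<longleftrightarrow>
    (\<forall>A' \<in> carrier_mat n n. same_pattern n A A' \<longrightarrow> observable n h A')"

text \<open>Arcs point from \<open>j\<close> to \<open>i\<close> when the entry in row \<open>i\<close> and column \<open>j\<close> is nonzero.\<close>

definition interaction_digraph :: "nat \<Rightarrow> 'a::zero mat \<Rightarrow> (nat, nat \<times> nat) pre_digraph" where
  "interaction_digraph n A =
    with_proj \<lparr>pverts = {..<n}, parcs = {(j, i). j < n \<and> i < n \<and> A $$ (i, j) \<noteq> 0}\<rparr>"

definition in_neighbors :: "('a, 'b) pre_digraph \<Rightarrow> 'a \<Rightarrow> 'a set" where
  "in_neighbors G v = {u. u \<rightarrow>\<^bsub>G\<^esub> v}"

text \<open>
  In the following, \<open>D\<close> is the set of directly observable vertices; the simple vertices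
  are \<open>verts G - D\<close>.
\<close>

definition property_P1 :: "('a, 'b) pre_digraph \<Rightarrow> 'a set \<Rightarrow> bool" where
  "property_P1 G D \<longleftrightarrow>
    (\<forall>v \<in> verts G - D. \<exists>v' \<in> verts G. in_neighbors G v' = {v})"

text \<open>
  A cycle is a list of arcs, and \<open>pre_digraph.cycle\<close> admits self-loops. As the walk is closed,
  the tails of its arcs are all of its vertices.
\<close>

definition cycle_verts :: "('a, 'b) pre_digraph \<Rightarrow> 'b awalk \<Rightarrow> 'a set" where
  "cycle_verts G c = tail G ` set c"

definition property_P2 :: "('a, 'b) pre_digraph \<Rightarrow> 'a set \<Rightarrow> bool" where
  "property_P2 G D \<longleftrightarrow>
    (\<forall>c. pre_digraph.cycle G c \<and> cycle_verts G c \<subseteq> verts G - D \<longrightarrow>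
      (\<exists>v \<in> verts G - cycle_verts G c. \<exists>u \<in> cycle_verts G c. in_neighbors G v = {u}))"

end

theory Submission
  imports Defs
begin

text \<open>
  By linearity, consider a trajectory that is never seen in the outputs, and let \<open>S\<close> be the set of
  vertices on which it is not identically zero; all of them are simple. If the unique in-neighbor
  of \<open>v'\<close> is \<open>v\<close> and \<open>v \<in> S\<close>, then \<open>v' \<in> S\<close>. Hence \<open>P\<^sub>1\<close> yields a map \<open>f\<close> from \<open>S\<close> to \<open>S\<close> along
  arcs that is injective, because \<open>v\<close> is the unique in-neighbor of \<open>f v\<close>, and thus bijective.
  If \<open>S\<close> were nonempty, \<open>f\<close> would run through a cycle of simple vertices; the vertex that \<open>P\<^sub>2\<close>
  provides lies in \<open>S\<close>, so it is the \<open>f\<close>-image of its in-neighbor and lies on the cycle after all.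
\<close>

text \<open>Pigeonhole produces some periodic point. A period \<open>m\<close> that is minimal among
  all points of \<open>S\<close>, not just along one orbit, forces distinct iterates: a collision at
  \<open>i < j < m\<close> would give the point \<open>(f ^^ i) t\<close> the smaller period
  \<open>j - i\<close>.\<close>

lemma finite_self_map_cycle:
  assumes "finite S" "S \<noteq> {}" "f ` S \<subseteq> S"
  obtains t m where "t \<in> S" "m > 0" "(f ^^ m) t = t" "inj_on (\<lambda>i. (f ^^ i) t) {..<m}"
proof -
  have closed: "(f ^^ i) t \<in> S" if "t \<in> S" for i t
    using that assms(3) by (induction i) auto
  define P where "P m \<longleftrightarrow> m > 0 \<and> (\<exists>t\<in>S. (f ^^ m) t = t)" for m
  have period: "P (j - i)" if "i < j" "t \<in> S" "(f ^^ i) t = (f ^^ j) t" for i j t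
  proof -
    have "(f ^^ (j - i)) ((f ^^ i) t) = (f ^^ i) t"
      using that by (metis comp_apply funpow_add le_add_diff_inverse2 less_imp_le)
    then show ?thesis using that closed unfolding P_def by auto
  qed
  obtain s where s: "s \<in> S" using assms(2) by blast
  have "\<not> inj (\<lambda>i. (f ^^ i) s)"
    using closed[OF s] assms(1)
    by (meson finite_imageD finite_subset image_subsetI infinite_UNIV_nat)
  then obtain i j where "i < j" "(f ^^ i) s = (f ^^ j) s"
    unfolding inj_on_def by (metis linorder_neqE_nat)
  then have ex: "\<exists>m. P m" using period s by blast
  define m where "m = (LEAST m. P m)"
  have Pm: "P m" unfolding m_def using ex by (rule LeastI_ex)
  then obtain t where t: "t \<in> S" "m > 0" "(f ^^ m) t = t" unfolding P_def by blast
  have no: "(f ^^ i) t \<noteq> (f ^^ j) t" if "i < j" "j < m" for i j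
  proof
    assume "(f ^^ i) t = (f ^^ j) t"
    then have "m \<le> j - i" unfolding m_def using period that t by (auto intro: Least_le)
    with that show False by auto
  qed
  have "inj_on (\<lambda>i. (f ^^ i) t) {..<m}"
    unfolding inj_on_def using no by (metis lessThan_iff linorder_neqE_nat)
  with t show ?thesis using that by blast
qed

lemma verts_interaction_digraph [simp]: "verts (interaction_digraph n A) = {..<n}"
  by (simp add: interaction_digraph_def)

lemma in_neighbors_interaction_digraph:
  "in_neighbors (interaction_digraph n A) i = {j. j < n \<and> i < n \<and> A $$ (i, j) \<noteq> 0}"
  by (auto simp: in_neighbors_def interaction_digraph_def arcs_ends_def arc_to_ends_def)

text \<open>Carries \<open>property_P1\<close> and \<open>property_P2\<close> from \<open>A\<close>
  over to every matrix of the same pattern.\<close>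

lemma interaction_digraph_same_pattern:
  "same_pattern n A A' \<Longrightarrow> interaction_digraph n A = interaction_digraph n A'"
  unfolding same_pattern_def interaction_digraph_def by (auto intro!: arg_cong[of _ _ with_proj])

lemma cas_orbit:
  assumes "tail G = fst" "head G = snd"
  shows "pre_digraph.cas G t (map (\<lambda>i. ((f ^^ i) t, (f ^^ Suc i) t)) [0..<m]) ((f ^^ m) t)"
proof -
  \<comment> \<open>Peeling off the first arc shifts the starting iterate, so the induction needs an
    arbitrary offset \<open>k\<close>.\<close>
  have "pre_digraph.cas G ((f ^^ k) t) (map (\<lambda>i. ((f ^^ i) t, (f ^^ Suc i) t)) [k..<k+l]) ((f ^^ (k+l)) t)"
    for k l
  proof (induction l arbitrary: k)
    case 0
    show ?case by (simp add: pre_digraph.cas.simps)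
  next
    case (Suc l)
    show ?case using Suc[of "Suc k"] assms
      by (simp add: pre_digraph.cas.simps upt_conv_Cons del: upt_Suc)
  qed
  from this[of 0 m] show ?thesis by simp
qed

text \<open>A walk of \<open>m\<close> arcs lists \<open>m + 1\<close> vertices, hence the range up
  to \<open>Suc m\<close>; if the orbit closes, the last entry repeats the first.\<close>

lemma awalk_verts_orbit:
  assumes "tail G = fst" "head G = snd"
  shows "pre_digraph.awalk_verts G t (map (\<lambda>i. ((f ^^ i) t, (f ^^ Suc i) t)) [0..<m])
    = map (\<lambda>i. (f ^^ i) t) [0..<Suc m]"
proof -
  have "pre_digraph.awalk_verts G ((f ^^ k) t) (map (\<lambda>i. ((f ^^ i) t, (f ^^ Suc i) t)) [k..<k+l])
    = map (\<lambda>i. (f ^^ i) t) [k..<Suc (k+l)]"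
    for k l
  proof (induction l arbitrary: k)
    case 0
    show ?case by (simp add: pre_digraph.awalk_verts.simps)
  next
    case (Suc l)
    show ?case using Suc[of "Suc k"] assms
      by (simp add: pre_digraph.awalk_verts.simps upt_conv_Cons del: upt_Suc)
  qed
  from this[of 0 m] show ?thesis by simp
qed

lemma state_carrier:
  "A \<in> carrier_mat n n \<Longrightarrow> x \<in> carrier_vec n \<Longrightarrow> state A x k \<in> carrier_vec n"
  by (induction k) auto

lemma state_minus:
  fixes A :: "'a::comm_ring mat"
  assumes "A \<in> carrier_mat n n" "x \<in> carrier_vec n" "z \<in> carrier_vec n"
  shows "state A (x - z) k = state A x k - state A z k"
  using assms state_carrier[OF assms(1,2)] state_carrier[OF assms(1,3)]
  by (induction k) (simp_all add: mult_minus_distrib_mat_vec[of _ n n])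

text \<open>Row \<open>i\<close> has its only nonzero entry in column \<open>v\<close>, which leaves
  one summand of the matrix-vector product.\<close>

lemma state_Suc_unique_in_neighbor:
  assumes "A \<in> carrier_mat n n" "x \<in> carrier_vec n"
    and "in_neighbors (interaction_digraph n A) i = {v}"
  shows "state A x (Suc k) $ i = A $$ (i, v) * state A x k $ v"
proof -
  have iv: "i < n" "v < n" and zero: "\<And>j. j < n \<Longrightarrow> j \<noteq> v \<Longrightarrow> A $$ (i, j) = 0"
    using assms(3) unfolding in_neighbors_interaction_digraph by blast+
  have "state A x (Suc k) $ i = (\<Sum>j<n. A $$ (i, j) * state A x k $ j)"
    using state_carrier[OF assms(1,2), of k] assms(1) iv
    by (auto simp: scalar_prod_def atLeast0LessThan)
  also have "\<dots> = (\<Sum>j\<in>{v}. A $$ (i, j) * state A x k $ j)"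
    using iv zero by (intro sum.mono_neutral_right) auto
  finally show ?thesis by simp
qed

text \<open>Intended for the difference \<open>w\<close> of two initial states with equal
  outputs.\<close>

lemma unobserved_state_eq_0:
  fixes A :: "'a::idom mat"
  assumes A: "A \<in> carrier_mat n n" and w: "w \<in> carrier_vec n"
    and P1: "property_P1 (interaction_digraph n A) {..<h}"
    and P2: "property_P2 (interaction_digraph n A) {..<h}"
    and unobserved: "\<And>k j. j < h \<Longrightarrow> j < n \<Longrightarrow> state A w k $ j = 0"
  shows "w = 0\<^sub>v n"
proof -
  let ?G = "interaction_digraph n A"
  define S where "S = {i. i < n \<and> (\<exists>k. state A w k $ i \<noteq> 0)}"
  have S_simple: "S \<subseteq> verts ?G - {..<h}"
    using unobserved by (auto simp: S_def not_less[symmetric])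
  have S_step: "i \<in> S" if nb: "in_neighbors ?G i = {v}" and v: "v \<in> S" for i v
  proof -
    obtain k where "state A w k $ v \<noteq> 0" using v unfolding S_def by blast
    moreover have "i < n" "A $$ (i, v) \<noteq> 0"
      using nb unfolding in_neighbors_interaction_digraph by blast+
    \<comment> \<open>In an integral domain the product of the nonzero entry and the nonzero state
      value cannot vanish.\<close>
    ultimately have "state A w (Suc k) $ i \<noteq> 0"
      using state_Suc_unique_in_neighbor[OF A w nb] by simp
    with \<open>i < n\<close> show ?thesis unfolding S_def by blast
  qed
  have "\<forall>v\<in>S. \<exists>v'. in_neighbors ?G v' = {v}"
    using P1 S_simple unfolding property_P1_def by blast
  then obtain f where f: "\<And>v. v \<in> S \<Longrightarrow> in_neighbors ?G (f v) = {v}" by metis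
  have fS: "f ` S \<subseteq> S" using f S_step by blast
  have fin: "finite S" unfolding S_def by simp
  have "inj_on f S" using f by (metis inj_onI singleton_inject)
  then have surj: "f ` S = S" using fin fS by (simp add: endo_inj_surj)
  have "S = {}"
  proof (rule ccontr)
    assume "S \<noteq> {}"
    obtain t m where t: "t \<in> S" "m > 0" "(f ^^ m) t = t"
      and inj: "inj_on (\<lambda>i. (f ^^ i) t) {..<m}"
      by (rule finite_self_map_cycle[OF fin \<open>S \<noteq> {}\<close> fS])
    \<comment> \<open>The arc for \<open>i = m - 1\<close> ends in \<open>(f ^^ m) t = t\<close>, so
      this walk closes up.\<close>
    define c where "c = map (\<lambda>i. ((f ^^ i) t, (f ^^ Suc i) t)) [0..<m]"
    have orbit: "(f ^^ i) t \<in> S" for i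
      using t(1) fS by (induction i) auto
    have tail_head: "tail ?G = fst" "head ?G = snd"
      by (simp_all add: interaction_digraph_def)
    have C: "cycle_verts ?G c = (\<lambda>i. (f ^^ i) t) ` {..<m}"
      unfolding cycle_verts_def c_def tail_head by force
    have "(v, f v) \<in> arcs ?G" if "v \<in> S" for v
      using f[OF that] unfolding in_neighbors_interaction_digraph
      by (auto simp: interaction_digraph_def)
    then have "set c \<subseteq> arcs ?G" using orbit unfolding c_def by auto
    moreover have "t \<in> verts ?G" using t(1) S_simple by blast
    ultimately have walk: "pre_digraph.awalk ?G t c t"
      unfolding pre_digraph.awalk_def
      using cas_orbit[OF tail_head, of t f m] t(3) by (simp add: c_def)
    \<comment> \<open>A cycle must have distinct vertices once the first list entry is dropped. The
      iterates 1 to \<open>m\<close> remain, and iterate \<open>m\<close> is \<open>t\<close>, that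
      is, iterate 0; so injectivity on \<open>{..<m}\<close> suffices.\<close>
    have "tl (pre_digraph.awalk_verts ?G t c) = map (\<lambda>i. (f ^^ i) t) [1..<Suc m]"
      unfolding c_def awalk_verts_orbit[OF tail_head] by (simp add: map_tl[symmetric] del: upt_Suc)
    also have "\<dots> = map (\<lambda>i. (f ^^ i) t) [1..<m] @ [t]"
      using t by simp
    finally have verts_c: "tl (pre_digraph.awalk_verts ?G t c) = map (\<lambda>i. (f ^^ i) t) [1..<m] @ [t]" .
    have "inj_on (\<lambda>i. (f ^^ i) t) {1..<m}"
      using inj by (rule inj_on_subset) auto
    moreover have "t \<noteq> (f ^^ i) t" if "i \<in> {1..<m}" for i
      using inj_onD[OF inj, of 0 i] that t(2) by auto
    ultimately have "distinct (tl (pre_digraph.awalk_verts ?G t c))"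
      unfolding verts_c by (auto simp: distinct_map)
    moreover have "c \<noteq> []" using t(2) by (simp add: c_def)
    ultimately have "pre_digraph.cycle ?G c"
      using walk unfolding pre_digraph.cycle_def by blast
    moreover have "cycle_verts ?G c \<subseteq> verts ?G - {..<h}"
      unfolding C using orbit S_simple by (meson image_subsetI subsetD)
    ultimately obtain v u where v: "v \<notin> cycle_verts ?G c" and u: "u \<in> cycle_verts ?G c"
      and vu: "in_neighbors ?G v = {u}"
      using P2 unfolding property_P2_def by blast
    have "u \<in> S" using u orbit unfolding C by auto
    with vu have "v \<in> S" by (rule S_step)
    \<comment> \<open>Both the preimage \<open>s\<close> and \<open>u\<close> are the unique
      in-neighbor of \<open>v\<close>, so \<open>s = u\<close> and \<open>v\<close> is the successor
      of \<open>u\<close> under \<open>f\<close>.\<close>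
    then obtain s where s: "s \<in> S" "v = f s" using surj by blast
    with f[OF s(1)] vu have "v = f u" by simp
    moreover obtain i where "i < m" "u = (f ^^ i) t" using u unfolding C by blast
    ultimately have "v = (f ^^ Suc i) t" "i < m" by auto
    \<comment> \<open>The index \<open>Suc i\<close> may reach \<open>m\<close> and leave the range;
      the orbit has then wrapped around to \<open>t\<close>.\<close>
    then have "\<exists>j<m. v = (f ^^ j) t"
    proof (cases "Suc i = m")
      case True
      with \<open>v = (f ^^ Suc i) t\<close> t(3) have "v = (f ^^ 0) t" by simp
      with t(2) show ?thesis by blast
    next
      case False
      with \<open>v = (f ^^ Suc i) t\<close> \<open>i < m\<close> show ?thesis
        by (intro exI[of _ "Suc i"]) simp
    qed
    then have "v \<in> cycle_verts ?G c" unfolding C by blast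
    with v show False by blast
  qed
  \<comment> \<open>Time 0 suffices, as \<open>state A w 0\<close> is \<open>w\<close>
    itself.\<close>
  then have "state A w 0 $ i = 0" if "i < n" for i
    using that unfolding S_def by blast
  then show ?thesis using w by auto
qed

theorem theorem8:
  fixes A :: "'p::prime_card mod_ring mat" and n h :: nat
  assumes "A \<in> carrier_mat n n"
    and "h \<le> n"
    and "property_P1 (interaction_digraph n A) {..<h}"
    and "property_P2 (interaction_digraph n A) {..<h}"
  shows "strongly_structurally_observable n h A"
  unfolding strongly_structurally_observable_def observable_def
proof (intro ballI impI)
  fix A' :: "'p mod_ring mat" and x z :: "'p mod_ring vec"
  assume A': "A' \<in> carrier_mat n n" and "same_pattern n A A'"
    and x: "x \<in> carrier_vec n" and z: "z \<in> carrier_vec n" and "x \<noteq> z"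
  then have G: "interaction_digraph n A = interaction_digraph n A'"
    by (simp add: interaction_digraph_same_pattern)
  show "\<exists>k. network_output h A' x k \<noteq> network_output h A' z k"
  proof (rule ccontr)
    assume "\<not> ?thesis"
    then have eq: "network_output h A' x k = network_output h A' z k" for k by blast
    \<comment> \<open>By linearity the trajectory of \<open>x - z\<close> is the difference of the
      two trajectories, and equal outputs make its observed coordinates vanish.\<close>
    have "state A' (x - z) k $ j = 0" if j: "j < h" "j < n" for j k
    proof -
      have "state A' x k $ j = state A' z k $ j"
        using arg_cong[OF eq[of k], of "\<lambda>u. u $ j"] j(1)
        by (simp add: network_output_def vec_first_def)
      then show ?thesis
        using j(2) state_carrier[OF A' z, of k] by (simp add: state_minus[OF A' x z])
    qed
    then have "x - z = 0\<^sub>v n"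
      using unobserved_state_eq_0[OF A' _ assms(3,4)[unfolded G], of "x - z"] x z by simp
    then have "x $ i = z $ i" if "i < n" for i
      using that z by (metis carrier_vecD eq_iff_diff_eq_0 index_minus_vec(1) index_zero_vec(1))
    then have "x = z" using x z by auto
    with \<open>x \<noteq> z\<close> show False by blast
  qed
qed

end
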